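(* Let $A_0,\dots,A_n\in\mathcal S^p$ be such that the system $\mathcal A(\mathbf x)\in\mathcal{COP}^p$ is consistent. The condition I) $\mathbf b(k,j)\in\mathrm{cone}\{\mathbf a(\mathbf t):\mathbf t\in T_{im}\}$ for all $k\in M(j)$ and all $j\in J$ is equivalent to the conjunction of the following two conditions: A1) the set $L:=\mathrm{cone}\{\mathbf a(\mathbf t):\mathbf t\in T_{im}\}$ is a (linear) subspace; B1) for any $\mathbf z\in\mathbb R^{n+1}$, the equalities $\boldsymbol\tau(i)^\top\mathcal B(\mathbf z)\boldsymbol\tau(j)=0$ for all $(i,j)\in V_0$ imply the equalities $\mathbf e_k^\top\mathcal B(\mathbf z)\boldsymbol\tau(j)=0$ for all $k\in M(j)$ and all $j\in J$.
   Context: Fix integers $p>1$, $n\ge 1$. $\mathcal S^p$ is the space of real symmetric $p\times p$ matrices; $\mathbf e_1,\dots,\mathbf e_p$ is the standard basis of $\mathbb R^p$; $\mathbb R^p_+$ is the set of vectors with non-negative components; $P=\{1,\dots,p\}$; $T=\{\mathbf t\in\mathbb R^p_+:\sum_{k\in P} t_k=1\}$; $\mathcal{COP}^p=\{D\in\mathcal S^p:\mathbf t^\top D\mathbf t\ge 0\ \forall \mathbf t\in\mathbb R^p_+\}$. For a set $\mathcal B$, $\mathrm{cone}\,\mathcal B$ is the set of all finite linear combinations of elements of $\mathcal B$ with non-negative coefficients (so $\mathrm{cone}\,\emptyset=\{0\}$). Given $A_0,\dots,A_n\in\mathcal S^p$, put $\mathcal A(\mathbf x)=A_0+\sum_{m=1}^n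 x_mA_m$ for $\mathbf x\in\mathbb R^n$, $\mathcal B(\mathbf z)=\sum_{m=0}^n z_mA_m$ for $\mathbf z=(z_0,\dots,z_n)^\top\in\mathbb R^{n+1}$, and $X=\{\mathbf x\in\mathbb R^n:\mathcal A(\mathbf x)\in\mathcal{COP}^p\}$. The system is consistent if $X\ne\emptyset$. $T_{im}=\{\mathbf t\in T:\mathbf t^\top\mathcal A(\mathbf x)\mathbf t=0\ \forall\mathbf x\in X\}$ is the set of normalized immobile indices; it is empty or a finite union of convex bounded polyhedra. $\{\boldsymbol\tau(j):j\in J\}$, $|J|<\infty$, is the set of vertices of $\mathrm{conv}\,T_{im}$ ($J=\emptyset$ if $T_{im}=\emptyset$). For $j\in J$: $M(j)=\{k\in P:\mathbf e_k^\top\mathcal A(\mathbf x)\boldsymbol\tau(j)=0\ \forall\mathbf x\in X\}$. Vectors in $\mathbb R^{n+1}$: $\mathbf a(\mathbf t)=(\mathbf t^\top A_m\mathbf t)_{m=0,\dots,n}$ for $\mathbf t\in T$, and $\mathbf b(k,j)=(\mathbf e_k^\top A_m\boldsymbol\tau(j))_{m=0,\dots,n}$ for $k\in P$, $j\in J$. Subsets $J(s)\subset J$, $s\in S$ ($S$ finite; the subsets need not be disjoint) are fixed such that $T_{im}=\bigcup_{s\in S}T_{im}(s)$ with $T_{im}(s)=\mathrm{conv}\{\boldsymbol\tau(j):j\in J(s)\}$, and such that for every $s\in S$ the set $P_*(s)=\bigcup_{j\in J(s)}\{k\in P:\tau_k(j)>0\}$ satisfies $P_*(s)\subset M(j)$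 for all $j\in J(s)$; it is known that such subsets exist. Numbering $J(s)=\{i_1,\dots,i_{k(s)}\}$, put $V(s)=\{(i_k,i_q):1\le k\le q\le k(s)\}$ and $V_0=\bigcup_{s\in S}V(s)$. *)

theory Defs
  imports "HOL-Analysis.Analysis"
begin

(* Matrix families are indexed by 'n option, so that real ^ 'n plays the role of R^n and
   real ^ 'n option that of R^(n+1): None is the index 0, Some m the index m. *)

definition nonneg_orthant :: "(real ^ 'p) set" where
  "nonneg_orthant = {t. \<forall>k. 0 \<le> t $ k}"

definition simplex_T :: "(real ^ 'p) set" where
  "simplex_T = {t \<in> nonneg_orthant. (\<Sum>k\<in>UNIV. t $ k) = 1}"

definition COP :: "(real ^ 'p ^ 'p) set" where
  "COP = {D. transpose D = D \<and> (\<forall>t\<in>nonneg_orthant. 0 \<le> t \<bullet> (D *v t))}"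

definition pencil_A :: "('n::finite option \<Rightarrow> real ^ 'p ^ 'p) \<Rightarrow> real ^ 'n \<Rightarrow> real ^ 'p ^ 'p" where
  "pencil_A A x = A None + (\<Sum>m\<in>UNIV. x $ m *\<^sub>R A (Some m))"

definition pencil_B :: "('n::finite option \<Rightarrow> real ^ 'p ^ 'p) \<Rightarrow> real ^ 'n option \<Rightarrow> real ^ 'p ^ 'p" where
  "pencil_B A z = (\<Sum>m\<in>UNIV. z $ m *\<^sub>R A m)"

definition feasible_set :: "('n::finite option \<Rightarrow> real ^ 'p ^ 'p) \<Rightarrow> (real ^ 'n) set" where
  "feasible_set A = {x. pencil_A A x \<in> COP}"

definition immobile_set :: "('n::finite option \<Rightarrow> real ^ 'p ^ 'p) \<Rightarrow> (real ^ 'p) set" where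
  "immobile_set A = {t \<in> simplex_T. \<forall>x\<in>feasible_set A. t \<bullet> (pencil_A A x *v t) = 0}"

(* The convex hull of the immobile indices is a polytope (or empty), so its vertices are
   exactly its extreme points. *)
definition immobile_vertices :: "('n::finite option \<Rightarrow> real ^ 'p ^ 'p) \<Rightarrow> (real ^ 'p) set" where
  "immobile_vertices A = {v. v extreme_point_of (convex hull (immobile_set A))}"

(* M(j) is zero_rows A (\<tau> j). *)
definition zero_rows :: "('n::finite option \<Rightarrow> real ^ 'p ^ 'p) \<Rightarrow> real ^ 'p \<Rightarrow> 'p set" where
  "zero_rows A v = {k. \<forall>x\<in>feasible_set A. axis k 1 \<bullet> (pencil_A A x *v v) = 0}"

definition vec_a :: "('n::finite option \<Rightarrow> real ^ 'p ^ 'p) \<Rightarrow> real ^ 'p \<Rightarrow> real ^ 'n option" where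
  "vec_a A t = (\<chi> m. t \<bullet> (A m *v t))"

(* b(k,j) is vec_b A k (\<tau> j). *)
definition vec_b :: "('n::finite option \<Rightarrow> real ^ 'p ^ 'p) \<Rightarrow> 'p \<Rightarrow> real ^ 'p \<Rightarrow> real ^ 'n option" where
  "vec_b A k v = (\<chi> m. axis k 1 \<bullet> (A m *v v))"

(* All finite non-negative combinations, including the empty one; not the library's cone hull,
   which only closes under scaling. *)
definition gen_cone :: "'a::real_vector set \<Rightarrow> 'a set" where
  "gen_cone B = {\<Sum>b\<in>F. c b *\<^sub>R b | F c. finite F \<and> F \<subseteq> B \<and> (\<forall>b\<in>F. 0 \<le> c b)}"

lemma gen_cone_eq_convex_cone_hull: "gen_cone B = convex_cone hull B"
proof
  show "gen_cone B \<subseteq> convex_cone hull B"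
  proof
    fix y assume "y \<in> gen_cone B"
    then obtain F c where F: "finite F" "F \<subseteq> B" "\<forall>b\<in>F. 0 \<le> c b"
      and y: "y = (\<Sum>b\<in>F. c b *\<^sub>R b)"
      unfolding gen_cone_def by blast
    have "(\<Sum>b\<in>F. c b *\<^sub>R b) \<in> convex_cone hull B"
      using F
    proof (induction F rule: finite_induct)
      case empty
      then show ?case by (simp add: convex_cone_hull_contains_0)
    next
      case (insert b F)
      then have "c b *\<^sub>R b \<in> convex_cone hull B"
        by (intro convex_cone_scaleR convex_cone_convex_cone_hull hull_inc) auto
      with insert show ?case
        by (simp add: convex_cone_hull_add)
    qed
    then show "y \<in> convex_cone hull B" using y by simp
  qed
next
  have "convex_cone (gen_cone B)"
    unfolding convex_cone_iff
  proof (intro conjI ballI allI impI)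
    show "0 \<in> gen_cone B" 
      unfolding gen_cone_def by (intro CollectI exI[of _ "{}"]) auto
  next
    fix x y assume "x \<in> gen_cone B" "y \<in> gen_cone B"
    then obtain F c G d where F: "finite F" "F \<subseteq> B" "\<forall>b\<in>F. 0 \<le> c b" "x = (\<Sum>b\<in>F. c b *\<^sub>R b)"
      and G: "finite G" "G \<subseteq> B" "\<forall>b\<in>G. 0 \<le> d b" "y = (\<Sum>b\<in>G. d b *\<^sub>R b)"
      unfolding gen_cone_def by blast
    let ?c = "\<lambda>b. if b \<in> F then c b else 0"
    let ?d = "\<lambda>b. if b \<in> G then d b else 0"
    have "x = (\<Sum>b\<in>F \<union> G. ?c b *\<^sub>R b)"
      unfolding F(4) using F(1) G(1) by (intro sum.mono_neutral_cong_left) auto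
    moreover have "y = (\<Sum>b\<in>F \<union> G. ?d b *\<^sub>R b)"
      unfolding G(4) using F(1) G(1) by (intro sum.mono_neutral_cong_left) auto
    ultimately have "x + y = (\<Sum>b\<in>F \<union> G. (?c b + ?d b) *\<^sub>R b)"
      by (simp only: sum.distrib scaleR_add_left)
    then show "x + y \<in> gen_cone B"
      unfolding gen_cone_def using F G
      by (intro CollectI exI[of _ "F \<union> G"] exI[of _ "\<lambda>b. ?c b + ?d b"]) auto
  next
    fix x and r :: real assume "x \<in> gen_cone B" and r: "0 \<le> r"
    then obtain F c where F: "finite F" "F \<subseteq> B" "\<forall>b\<in>F. 0 \<le> c b" "x = (\<Sum>b\<in>F. c b *\<^sub>R b)"
      unfolding gen_cone_def by blast
    then show "r *\<^sub>R x \<in> gen_cone B"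
      unfolding gen_cone_def using r
      by (intro CollectI exI[of _ F] exI[of _ "\<lambda>b. r * c b"]) (auto simp: scaleR_sum_right)
  qed
  moreover have "B \<subseteq> gen_cone B"
  proof
    fix b assume "b \<in> B"
    then show "b \<in> gen_cone B"
      unfolding gen_cone_def by (intro CollectI exI[of _ "{b}"] exI[of _ "\<lambda>_. 1"]) auto
  qed
  ultimately show "convex_cone hull B \<subseteq> gen_cone B"
    by (simp add: hull_minimal)
qed

(* num numbers a k-element index set by 1, ..., k. *)
definition ordered_pairs :: "(nat \<Rightarrow> 'j) \<Rightarrow> nat \<Rightarrow> ('j \<times> 'j) set" where
  "ordered_pairs num k = {(num r, num q) | r q. 1 \<le> r \<and> r \<le> q \<and> q \<le> k}"

end

theory Submission
  imports Defs
begin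

text \<open>
  Pairing a vector \<open>z\<close> with the vectors \<open>a\<close> and \<open>b\<close> evaluates the form of \<open>B(z)\<close>:
  \<open>z \<bullet> a(t) = t\<^sup>T B(z) t\<close> and \<open>z \<bullet> b(k,j) = e\<^sub>k\<^sup>T B(z) \<tau>(j)\<close>. By polarization along the
  pieces of the immobile set, the equalities over \<open>V\<^sub>0\<close> say precisely that \<open>z\<close> is orthogonal
  to \<open>L\<close>. So condition B1 says that every \<open>b(k,j)\<close> with \<open>k \<in> M(j)\<close> is annihilated by the
  orthogonal complement of \<open>L\<close>. Once \<open>L\<close> is a subspace this is the same as membership in
  \<open>L\<close>, and membership in \<open>L\<close> implies it in any case.

  What remains is that condition I makes \<open>L\<close> a subspace. A convex cone is a subspace as soon as
  every functional that is nonnegative on it vanishes on it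
  (\<open>subspace_if_no_proper_support\<close>). Let \<open>z\<close> be nonnegative on \<open>L\<close>, hence by I on the
  vectors \<open>b(k,j)\<close>. A point \<open>x\<close> in the relative interior of the feasible set is strictly
  positive wherever some feasible point is: on all non-immobile indices and on all rows outside
  \<open>M(j)\<close> (\<open>minimally_vanishing_feasible_point\<close>). For large \<open>c\<close> the matrix
  \<open>D = B(z) + c A(x)\<close> therefore has nonnegative rows \<open>e\<^sub>k\<^sup>T D \<tau>(j)\<close> for all \<open>k\<close> and \<open>j\<close>,
  and its form is nonnegative on the compact set of those simplex points from which no multiple
  of a vertex \<open>\<tau>(j)\<close> can be subtracted. Subtracting vertices from an arbitrary nonnegative
  vector reduces it to \<open>0\<close> or a multiple of such a point, so \<open>D\<close> is copositive (\<open>copositive_by_peeling\<close>). But \<open>D\<close>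
  is a positive multiple of some \<open>A(y)\<close>, so \<open>y\<close> is feasible and both \<open>D\<close> and \<open>A(x)\<close> vanish
  on the immobile indices. Hence so does \<open>B(z)\<close>, that is, \<open>z\<close> vanishes on \<open>L\<close>
  (\<open>immobile_form_vanishes\<close>).
\<close>

section \<open>Bilinear forms of the matrix pencils\<close>

lemma nonneg_orthantD: "t \<in> nonneg_orthant \<Longrightarrow> 0 \<le> t $ k"
  by (simp add: nonneg_orthant_def)

lemma form_lincomb:
  fixes M N :: "real ^ 'p::finite ^ 'q::finite"
  shows "u \<bullet> ((c *\<^sub>R M + d *\<^sub>R N) *v v) = c * (u \<bullet> (M *v v)) + d * (u \<bullet> (N *v v))"
  by (simp add: matrix_vector_mult_add_rdistrib scaleR_matrix_vector_assoc[symmetric] inner_add_right)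

lemma form_sum:
  fixes M :: "'i \<Rightarrow> real ^ 'p::finite ^ 'q::finite"
  shows "u \<bullet> ((\<Sum>i\<in>I. c i *\<^sub>R M i) *v v) = (\<Sum>i\<in>I. c i * (u \<bullet> (M i *v v)))"
proof (induction I rule: infinite_finite_induct)
  case (insert i I)
  then show ?case
    using form_lincomb[of u "c i" "M i" 1 "\<Sum>i\<in>I. c i *\<^sub>R M i" v] by simp
qed auto

lemma form_symmetric:
  fixes D :: "real ^ 'p::finite ^ 'p"
  assumes "transpose D = D"
  shows "u \<bullet> (D *v v) = v \<bullet> (D *v u)"
proof -
  have "u \<bullet> (D *v v) = (u v* D) \<bullet> v" by (rule dot_lmul_matrix[symmetric])
  also have "\<dots> = (transpose D *v u) \<bullet> v" by simp
  finally show ?thesis using assms by (simp add: inner_commute)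
qed

lemma quadratic_form_add:
  fixes D :: "real ^ 'p::finite ^ 'p"
  assumes "transpose D = D"
  shows "(u + c *\<^sub>R v) \<bullet> (D *v (u + c *\<^sub>R v))
    = u \<bullet> (D *v u) + 2 * c * (u \<bullet> (D *v v)) + c\<^sup>2 * (v \<bullet> (D *v v))"
  using form_symmetric[OF assms, of v u]
  by (simp add: matrix_vector_right_distrib matrix_vector_mult_scaleR inner_add_left inner_add_right
      power2_eq_square algebra_simps)

lemma form_rows:
  fixes D :: "real ^ 'p::finite ^ 'p"
  shows "u \<bullet> (D *v v) = (\<Sum>k\<in>UNIV. u $ k * (axis k 1 \<bullet> (D *v v)))"
  by (simp add: inner_vec_def[of u] inner_axis')

lemma inner_vec_a: "z \<bullet> vec_a A t = t \<bullet> (pencil_B A z *v t)"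
  unfolding vec_a_def pencil_B_def form_sum by (simp add: inner_vec_def[of z])

lemma inner_vec_b: "z \<bullet> vec_b A k v = axis k 1 \<bullet> (pencil_B A z *v v)"
  unfolding vec_b_def pencil_B_def form_sum by (simp add: inner_vec_def[of z])

lemma transpose_lincomb:
  fixes M N :: "real ^ 'p::finite ^ 'p"
  shows "transpose (c *\<^sub>R M + d *\<^sub>R N) = c *\<^sub>R transpose M + d *\<^sub>R transpose N"
  by (simp add: transpose_def vec_eq_iff)

lemma transpose_pencil_B:
  fixes A :: "'n::finite option \<Rightarrow> real ^ 'p::finite ^ 'p"
  assumes "\<And>m. transpose (A m) = A m"
  shows "transpose (pencil_B A z) = pencil_B A z"
proof -
  have "A m $ i $ j = A m $ j $ i" for m i j
    using assms[of m] by (simp add: transpose_def vec_eq_iff)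
  then show ?thesis
    by (simp add: transpose_def pencil_B_def vec_eq_iff)
qed

lemma sum_option:
  fixes f :: "'n::finite option \<Rightarrow> 'b::comm_monoid_add"
  shows "(\<Sum>m\<in>UNIV. f m) = f None + (\<Sum>m\<in>UNIV. f (Some m))"
  by (simp add: UNIV_option_conv sum.reindex)

lemma pencil_A_lincomb:
  assumes "c + d = 1"
  shows "pencil_A A (c *\<^sub>R x + d *\<^sub>R y) = c *\<^sub>R pencil_A A x + d *\<^sub>R pencil_A A y"
proof -
  have "A None = c *\<^sub>R A None + d *\<^sub>R A None"
    using assms by (metis scaleR_add_left scaleR_one)
  then show ?thesis
    by (simp add: pencil_A_def scaleR_add_left scaleR_add_right sum.distrib scaleR_sum_right)
qed

text \<open>Dehomogenization: as \<open>pencil_A A x\<close> is \<open>pencil_B\<close> at the vector with \<open>None\<close>-entry 1 and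
  remaining entries \<open>x\<close>, a combination whose total \<open>None\<close>-entry is positive can be rescaled
  to a member of the inhomogeneous pencil.\<close>

lemma pencil_B_plus_pencil_A:
  fixes A :: "'n::finite option \<Rightarrow> real ^ 'p::finite ^ 'p"
  assumes "0 < z $ None + c"
  obtains x where "pencil_B A z + c *\<^sub>R pencil_A A y = (z $ None + c) *\<^sub>R pencil_A A x"
proof
  let ?r = "z $ None + c"
  let ?x = "\<chi> m. (z $ Some m + c * y $ m) / ?r"
  have "?r *\<^sub>R ((?x $ m) *\<^sub>R A (Some m)) = z $ Some m *\<^sub>R A (Some m) + c *\<^sub>R (y $ m *\<^sub>R A (Some m))" for m
    using assms by (simp add: scaleR_add_left)
  then show "pencil_B A z + c *\<^sub>R pencil_A A y = ?r *\<^sub>R pencil_A A ?x"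
    by (simp add: pencil_B_def pencil_A_def sum_option scaleR_add_right scaleR_sum_right sum.distrib
        scaleR_add_left del: vec_lambda_beta scaleR_scaleR)
qed

section \<open>Copositive matrices\<close>

lemma convex_cone_COP: "convex_cone (COP :: (real ^ 'p::finite ^ 'p) set)"
proof -
  have "c *\<^sub>R M + d *\<^sub>R N \<in> COP" if "M \<in> COP" "N \<in> COP" "0 \<le> c" "0 \<le> d"
    for M N :: "real ^ 'p ^ 'p" and c d
    using that by (auto simp: COP_def transpose_lincomb form_lincomb)
  from this[of _ _ 1 1] this[of _ _ _ 0] show ?thesis
    by (auto simp: convex_cone_iff) (simp add: COP_def transpose_def vec_eq_iff)
qed

lemma convex_feasible_set: "convex (feasible_set A)"
  using convex_cone_COP unfolding convex_cone_def convex_def feasible_set_def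
  by (auto simp: pencil_A_lincomb)

text \<open>A zero \<open>t\<close> of the form minimizes it over the orthant, so the directional derivative
  towards \<open>axis k 1\<close>, which is twice the row product, cannot be negative.\<close>

lemma copositive_zero_row_nonneg:
  fixes D :: "real ^ 'p::finite ^ 'p"
  assumes D: "D \<in> COP" and t: "t \<in> nonneg_orthant" and zero: "t \<bullet> (D *v t) = 0"
  shows "0 \<le> axis k 1 \<bullet> (D *v t)"
proof (rule ccontr)
  define b where "b = axis k 1 \<bullet> (D *v t)"
  define d where "d = axis k 1 \<bullet> (D *v axis k 1)"
  assume "\<not> 0 \<le> axis k 1 \<bullet> (D *v t)"
  then have b: "b < 0" by (simp add: b_def)
  \<comment> \<open>a step so small that the quadratic term does not compensate the negative linear one\<close>
  define e where "e = - b / (\<bar>d\<bar> + 1)"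
  have e: "0 < e" unfolding e_def using b by (intro divide_pos_pos) auto
  have sym: "transpose D = D" using D by (simp add: COP_def)
  have "t + e *\<^sub>R axis k 1 \<in> nonneg_orthant"
    using t e by (simp add: nonneg_orthant_def axis_def)
  then have "0 \<le> (t + e *\<^sub>R axis k 1) \<bullet> (D *v (t + e *\<^sub>R axis k 1))"
    using D by (simp add: COP_def)
  also have "\<dots> = 2 * e * b + e\<^sup>2 * d"
    using zero form_symmetric[OF sym, of t "axis k 1"]
    by (simp add: quadratic_form_add[OF sym] b_def d_def)
  also have "\<dots> = e * (2 * b + e * d)" by (simp add: power2_eq_square algebra_simps)
  finally have "0 \<le> 2 * b + e * d" using e by (simp add: zero_le_mult_iff)
  moreover have "e * d \<le> e * (\<bar>d\<bar> + 1)" using e by (intro mult_left_mono) auto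
  moreover have "e * (\<bar>d\<bar> + 1) = - b" unfolding e_def by (simp add: field_simps)
  ultimately show False using b by linarith
qed

lemma form_nonneg_if_rows_nonneg:
  fixes D :: "real ^ 'p::finite ^ 'p"
  assumes "u \<in> nonneg_orthant" "\<And>k. 0 \<le> axis k 1 \<bullet> (D *v v)"
  shows "0 \<le> u \<bullet> (D *v v)"
  unfolding form_rows[of u] using assms by (auto intro!: sum_nonneg simp: nonneg_orthantD)

text \<open>If the support of some \<open>v \<in> V\<close> lies in that of \<open>t\<close>, subtract from \<open>t\<close> as much of \<open>v\<close> as
  the orthant permits: one coordinate of \<open>t\<close> becomes zero, and by nonnegativity of the rows at
  \<open>v\<close> the form does not increase. Hence induction on the size of the support reduces
  copositivity to those \<open>t\<close> from which nothing can be subtracted.\<close>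

lemma copositive_by_peeling:
  fixes D :: "real ^ 'p::finite ^ 'p" and V :: "(real ^ 'p) set"
  assumes sym: "transpose D = D"
    and V: "V \<subseteq> nonneg_orthant - {0}"
    and rows: "\<And>v k. v \<in> V \<Longrightarrow> 0 \<le> axis k 1 \<bullet> (D *v v)"
    and irreducible: "\<And>t. t \<in> nonneg_orthant \<Longrightarrow> \<forall>v\<in>V. \<exists>k. 0 < v $ k \<and> t $ k = 0
           \<Longrightarrow> 0 \<le> t \<bullet> (D *v t)"
  shows "D \<in> COP"
proof -
  have "0 \<le> t \<bullet> (D *v t)" if "t \<in> nonneg_orthant" for t
    using that
  proof (induction "card {k. 0 < t $ k}" arbitrary: t rule: less_induct)
    case less
    show ?case
    proof (cases "\<forall>v\<in>V. \<exists>k. 0 < v $ k \<and> t $ k = 0")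
      case True
      with irreducible less.prems show ?thesis by blast
    next
      case False
      then obtain v where v: "v \<in> V" and supp: "\<And>k. 0 < v $ k \<Longrightarrow> 0 < t $ k"
        using nonneg_orthantD[OF less.prems] by (metis less_eq_real_def)
      have v0: "0 \<le> v $ k" for k using v V by (auto simp: nonneg_orthantD)
      have "v \<noteq> 0" using v V by blast
      then obtain k0 where "0 < v $ k0"
        using v0 by (metis less_eq_real_def vec_eq_iff zero_index)
      define K where "K = {k. 0 < v $ k}"
      \<comment> \<open>the largest multiple of \<open>v\<close> that can be subtracted from \<open>t\<close> inside the orthant\<close>
      define c where "c = Min ((\<lambda>k. t $ k / v $ k) ` K)"
      have K: "finite K" "K \<noteq> {}" using \<open>0 < v $ k0\<close> by (auto simp: K_def)
      have c_le: "c \<le> t $ k / v $ k" if "0 < v $ k" for k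
        unfolding c_def using that K by (intro Min_le) (auto simp: K_def)
      have "c \<in> (\<lambda>k. t $ k / v $ k) ` K"
        unfolding c_def using K by (intro Min_in) auto
      then obtain l where l: "0 < v $ l" "c = t $ l / v $ l" by (auto simp: K_def)
      have c: "0 < c" using l supp[of l] by simp
      define w where "w = t - c *\<^sub>R v"
      have w: "w \<in> nonneg_orthant"
      proof -
        have "c * v $ k \<le> t $ k" for k
        proof (cases "0 < v $ k")
          case True
          then show ?thesis using c_le[of k] by (simp add: pos_le_divide_eq)
        next
          case False
          then have "v $ k = 0" using v0[of k] by simp
          then show ?thesis using nonneg_orthantD[OF less.prems, of k] by simp
        qed
        then show ?thesis by (simp add: nonneg_orthant_def w_def)
      qed
      have "{k. 0 < w $ k} \<subseteq> {k. 0 < t $ k}"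
      proof clarify
        fix k assume "0 < w $ k"
        moreover have "0 \<le> c * v $ k" using c v0[of k] by simp
        ultimately show "0 < t $ k" by (simp add: w_def)
      qed
      moreover have "l \<notin> {k. 0 < w $ k}" "l \<in> {k. 0 < t $ k}"
        using l supp[of l] by (auto simp: w_def)
      ultimately have "{k. 0 < w $ k} \<subset> {k. 0 < t $ k}" by blast
      then have "card {k. 0 < w $ k} < card {k. 0 < t $ k}"
        by (intro psubset_card_mono) auto
      then have "0 \<le> w \<bullet> (D *v w)" using less.hyps w by blast
      moreover have "0 \<le> w \<bullet> (D *v v)" "0 \<le> v \<bullet> (D *v v)"
        using form_nonneg_if_rows_nonneg rows v w V by blast+
      moreover have "t = w + c *\<^sub>R v" by (simp add: w_def)
      ultimately show ?thesis using c by (simp add: quadratic_form_add[OF sym])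
    qed
  qed
  then show ?thesis using sym by (simp add: COP_def)
qed

section \<open>Feasible points in the relative interior\<close>

text \<open>From any \<open>y \<in> X\<close> one can move through \<open>x\<close> slightly beyond it without leaving \<open>X\<close>; if
  \<open>f y\<close> were positive, the affine function \<open>f\<close> would be negative there.\<close>

lemma vanishes_on_convex_if_zero_in_rel_interior:
  fixes f :: "'a::euclidean_space \<Rightarrow> real"
  assumes X: "convex X" and x: "x \<in> rel_interior X"
    and affine: "\<And>c d u v. c + d = 1 \<Longrightarrow> f (c *\<^sub>R u + d *\<^sub>R v) = c * f u + d * f v"
    and nonneg: "\<And>y. y \<in> X \<Longrightarrow> 0 \<le> f y" and zero: "f x = 0" and y: "y \<in> X"
  shows "f y = 0"
proof -
  have "X \<noteq> {}" using y by blast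
  then obtain e where e: "1 < e" "(1 - e) *\<^sub>R y + e *\<^sub>R x \<in> X"
    using convex_rel_interior_iff[OF X] x y by blast
  have "0 \<le> (1 - e) * f y"
    using nonneg[OF e(2)] affine[of "1 - e" e y x] zero by simp
  then show ?thesis using e(1) nonneg[OF y] by (simp add: zero_le_mult_iff)
qed

lemma pencil_form_vanishes:
  assumes "x \<in> rel_interior (feasible_set A)"
    and "\<And>y. y \<in> feasible_set A \<Longrightarrow> 0 \<le> u \<bullet> (pencil_A A y *v v)"
    and "u \<bullet> (pencil_A A x *v v) = 0" and "y \<in> feasible_set A"
  shows "u \<bullet> (pencil_A A y *v v) = 0"
  by (rule vanishes_on_convex_if_zero_in_rel_interior[where f = "\<lambda>y. u \<bullet> (pencil_A A y *v v)",
        OF convex_feasible_set assms(1) _ assms(2) assms(3) assms(4)])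
    (simp_all add: pencil_A_lincomb form_lincomb)

text \<open>A single feasible point witnesses all non-immobile indices and all rows outside the sets
  \<open>zero_rows A v\<close> simultaneously: these values are affine and nonnegative on the feasible set, so
  if one is zero at a relative interior point, it is zero everywhere.\<close>

lemma minimally_vanishing_feasible_point:
  fixes A :: "'n::finite option \<Rightarrow> real ^ 'p::finite ^ 'p"
  assumes "feasible_set A \<noteq> {}"
  obtains x where "x \<in> feasible_set A"
    and "\<And>t. t \<in> simplex_T - immobile_set A \<Longrightarrow> 0 < t \<bullet> (pencil_A A x *v t)"
    and "\<And>v k. v \<in> immobile_set A \<Longrightarrow> k \<notin> zero_rows A v \<Longrightarrow> 0 < axis k 1 \<bullet> (pencil_A A x *v v)"
proof -
  obtain x where x: "x \<in> rel_interior (feasible_set A)"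
    using assms rel_interior_eq_empty[OF convex_feasible_set] by blast
  then have xX: "x \<in> feasible_set A" using rel_interior_subset by blast
  show thesis
  proof (rule that[OF xX])
    fix t assume t: "t \<in> simplex_T - immobile_set A"
    have nn: "0 \<le> t \<bullet> (pencil_A A y *v t)" if "y \<in> feasible_set A" for y
      using that t by (auto simp: feasible_set_def COP_def simplex_T_def)
    have "t \<bullet> (pencil_A A x *v t) \<noteq> 0"
      using pencil_form_vanishes[OF x nn] t by (auto simp: immobile_set_def)
    with nn[OF xX] show "0 < t \<bullet> (pencil_A A x *v t)" by simp
  next
    fix v k assume v: "v \<in> immobile_set A" and k: "k \<notin> zero_rows A v"
    have nn: "0 \<le> axis k 1 \<bullet> (pencil_A A y *v v)" if "y \<in> feasible_set A" for y
      using that v by (intro copositive_zero_row_nonneg)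
        (auto simp: feasible_set_def immobile_set_def simplex_T_def)
    have "axis k 1 \<bullet> (pencil_A A x *v v) \<noteq> 0"
      using pencil_form_vanishes[OF x nn] k by (auto simp: zero_rows_def)
    with nn[OF xX] show "0 < axis k 1 \<bullet> (pencil_A A x *v v)" by simp
  qed
qed

section \<open>Domination on compact sets\<close>

lemma eventually_dominates_on_compact:
  fixes f g :: "'a::topological_space \<Rightarrow> real"
  assumes K: "compact K" and f: "continuous_on K f" and g: "continuous_on K g"
    and pos: "\<And>t. t \<in> K \<Longrightarrow> 0 < f t"
  shows "\<forall>\<^sub>F c in at_top. \<forall>t\<in>K. 0 \<le> g t + c * f t"
proof (cases "K = {}")
  case False
  have "continuous_on K (\<lambda>t. - g t / f t)"
    using f g pos by (intro continuous_intros) (auto simp: less_imp_neq[THEN not_sym])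
  then obtain s where s: "\<And>t. t \<in> K \<Longrightarrow> - g t / f t \<le> - g s / f s"
    using continuous_attains_sup[OF K False] by blast
  show ?thesis
  proof (rule eventually_mono[OF eventually_ge_at_top[of "- g s / f s"]], intro ballI)
    fix c t assume "- g s / f s \<le> c" "t \<in> K"
    then have "- g t / f t \<le> c" and ft: "0 < f t" using s[of t] pos by force+
    then have "- g t \<le> c * f t" by (simp only: pos_divide_le_eq[OF ft])
    then show "0 \<le> g t + c * f t" by simp
  qed
qed simp

lemma eventually_dominates:
  fixes a b :: real
  assumes "0 < b" shows "\<forall>\<^sub>F c in at_top. 0 \<le> a + c * b"
  using eventually_dominates_on_compact[of "{0::real}" "\<lambda>_. b" "\<lambda>_. a"] assms by simp

lemma immobile_subset_nonneg: "immobile_set A \<subseteq> nonneg_orthant - {0}"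
  by (auto simp: immobile_set_def simplex_T_def)

lemma bounded_simplex_T: "bounded (simplex_T :: (real ^ 'p::finite) set)"
proof (rule boundedI)
  fix t :: "real ^ 'p" assume "t \<in> simplex_T"
  then have "(\<Sum>k\<in>UNIV. \<bar>t $ k\<bar>) = 1"
    by (simp add: simplex_T_def nonneg_orthant_def)
  then show "norm t \<le> 1" using norm_le_l1_cart[of t] by simp
qed

text \<open>The simplex points that are irreducible in the sense of \<open>copositive_by_peeling\<close> form a union
  of faces. Compactness is what allows one multiple of \<open>A(x)\<close> to dominate \<open>B(z)\<close> on all of
  them; the complement of the immobile set in the simplex need not be closed.\<close>

lemma compact_simplex_avoiding:
  fixes V :: "(real ^ 'p::finite) set"
  shows "compact {t \<in> simplex_T. \<forall>v\<in>V. \<exists>k. 0 < v $ k \<and> t $ k = 0}"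
proof (rule compact_eq_bounded_closed[THEN iffD2, OF conjI])
  show "bounded {t \<in> simplex_T. \<forall>v\<in>V. \<exists>k. 0 < v $ k \<and> t $ k = 0}"
    using bounded_simplex_T by (rule bounded_subset) auto
  show "closed {t \<in> simplex_T. \<forall>v\<in>V. \<exists>k. 0 < v $ k \<and> t $ k = 0}"
  proof -
    have "{t \<in> simplex_T. \<forall>v\<in>V. \<exists>k. 0 < v $ k \<and> t $ k = 0}
        = {t. (\<forall>k. 0 \<le> t $ k) \<and> (\<Sum>k\<in>UNIV. t $ k) = 1}
          \<inter> (\<Inter>v\<in>V. \<Union>k\<in>{k. 0 < v $ k}. {t. t $ k = 0})"
      by (auto simp: simplex_T_def nonneg_orthant_def)
    moreover have "closed \<dots>"
    proof (intro closed_Int closed_INT ballI closed_UN finite)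
      show "closed {t :: real ^ 'p. (\<forall>k. 0 \<le> t $ k) \<and> (\<Sum>k\<in>UNIV. t $ k) = 1}"
        by (intro closed_Collect_conj closed_Collect_all closed_Collect_le closed_Collect_eq
            continuous_intros)
      show "closed {t :: real ^ 'p. t $ k = 0}" for k
        by (intro closed_Collect_eq continuous_intros)
    qed
    ultimately show ?thesis by simp
  qed
qed

lemma nonneg_form_if_nonneg_on_simplex:
  fixes D :: "real ^ 'p::finite ^ 'p" and V :: "(real ^ 'p) set"
  assumes simplex: "\<And>t. t \<in> simplex_T \<Longrightarrow> \<forall>v\<in>V. \<exists>k. 0 < v $ k \<and> t $ k = 0
           \<Longrightarrow> 0 \<le> t \<bullet> (D *v t)"
    and t: "t \<in> nonneg_orthant" "\<forall>v\<in>V. \<exists>k. 0 < v $ k \<and> t $ k = 0"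
  shows "0 \<le> t \<bullet> (D *v t)"
proof (cases "t = 0")
  case False
  define r where "r = (\<Sum>k\<in>UNIV. t $ k)"
  have "0 \<le> r" unfolding r_def using t(1) by (simp add: sum_nonneg nonneg_orthantD)
  moreover have "r \<noteq> 0"
    unfolding r_def using t(1) False
    by (subst sum_nonneg_eq_0_iff) (auto simp: nonneg_orthantD vec_eq_iff)
  ultimately have r: "0 < r" by simp
  define s where "s = (1 / r) *\<^sub>R t"
  have "s \<in> simplex_T"
    using t(1) r
    by (simp add: simplex_T_def nonneg_orthant_def s_def r_def flip: sum_divide_distrib)
  moreover have "\<forall>v\<in>V. \<exists>k. 0 < v $ k \<and> s $ k = 0"
    using t(2) by (auto simp: s_def)
  ultimately have "0 \<le> s \<bullet> (D *v s)" by (rule simplex)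
  moreover have "t \<bullet> (D *v t) = r\<^sup>2 * (s \<bullet> (D *v s))"
    using r by (simp add: s_def matrix_vector_mult_scaleR power2_eq_square)
  ultimately show ?thesis by simp
qed simp

section \<open>Positivity on the rows forces vanishing\<close>

text \<open>The hypotheses on \<open>V\<close> hold for the vertices of the convex hull of the immobile set; the
  condition on supports keeps the irreducible simplex points away from that set.
  Rows that some feasible point does not annihilate become positive after adding a large multiple
  of \<open>A(x)\<close>, and the conclusion comes from feasibility of the rescaled sum.\<close>

lemma immobile_form_vanishes:
  fixes A :: "'n::finite option \<Rightarrow> real ^ 'p::finite ^ 'p"
  assumes symmetric: "\<And>m. transpose (A m) = A m"
    and consistent: "feasible_set A \<noteq> {}"
    and V: "finite V" "V \<subseteq> immobile_set A"
    and support: "\<And>t. t \<in> immobile_set A \<Longrightarrow> \<exists>v\<in>V. \<forall>k. 0 < v $ k \<longrightarrow> 0 < t $ k"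
    and z: "\<And>v k. v \<in> V \<Longrightarrow> k \<in> zero_rows A v \<Longrightarrow> 0 \<le> axis k 1 \<bullet> (pencil_B A z *v v)"
    and t: "t \<in> immobile_set A"
  shows "t \<bullet> (pencil_B A z *v t) = 0"
proof -
  obtain x where x: "x \<in> feasible_set A"
    and pos: "\<And>t. t \<in> simplex_T - immobile_set A \<Longrightarrow> 0 < t \<bullet> (pencil_A A x *v t)"
    and pos_row: "\<And>v k. v \<in> immobile_set A \<Longrightarrow> k \<notin> zero_rows A v
            \<Longrightarrow> 0 < axis k 1 \<bullet> (pencil_A A x *v v)"
    using minimally_vanishing_feasible_point[OF consistent] by blast
  define K where "K = {t \<in> simplex_T. \<forall>v\<in>V. \<exists>k. 0 < v $ k \<and> t $ k = 0}"
  have K: "K \<subseteq> simplex_T - immobile_set A"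
    unfolding K_def using support by fastforce
  define D where "D c = pencil_B A z + c *\<^sub>R pencil_A A x" for c
  have D: "u \<bullet> (D c *v v) = u \<bullet> (pencil_B A z *v v) + c * (u \<bullet> (pencil_A A x *v v))" for u v c
    using form_lincomb[of u 1 "pencil_B A z" c "pencil_A A x" v] by (simp add: D_def)
  have "\<forall>\<^sub>F c in at_top. \<forall>t\<in>K. 0 \<le> t \<bullet> (D c *v t)"
    unfolding D
  proof (rule eventually_dominates_on_compact)
    show "compact K" unfolding K_def by (rule compact_simplex_avoiding)
  qed (use pos K in \<open>auto intro!: continuous_intros\<close>)
  moreover have "\<forall>\<^sub>F c in at_top. \<forall>v\<in>V. \<forall>k\<in>UNIV. 0 \<le> axis k 1 \<bullet> (D c *v v)"
  proof (intro eventually_ball_finite ballI V(1) finite)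
    fix v k assume v: "v \<in> V"
    show "\<forall>\<^sub>F c in at_top. 0 \<le> axis k 1 \<bullet> (D c *v v)"
    proof (cases "k \<in> zero_rows A v")
      case True
      then have "axis k 1 \<bullet> (pencil_A A x *v v) = 0" using x by (simp add: zero_rows_def)
      then show ?thesis using z[OF v True] by (simp add: D)
    next
      case False
      then show ?thesis
        unfolding D using v V(2) by (intro eventually_dominates pos_row) auto
    qed
  qed
  moreover have "\<forall>\<^sub>F c in at_top. 0 < z $ None + c"
    using eventually_gt_at_top[of "- (z $ None)"] by eventually_elim simp
  ultimately have "\<forall>\<^sub>F c in at_top. (\<forall>t\<in>K. 0 \<le> t \<bullet> (D c *v t))
      \<and> (\<forall>v\<in>V. \<forall>k\<in>UNIV. 0 \<le> axis k 1 \<bullet> (D c *v v)) \<and> 0 < z $ None + c"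
    by eventually_elim blast
  then obtain c where cK: "\<And>t. t \<in> K \<Longrightarrow> 0 \<le> t \<bullet> (D c *v t)"
    and cV: "\<And>v k. v \<in> V \<Longrightarrow> 0 \<le> axis k 1 \<bullet> (D c *v v)" and c: "0 < z $ None + c"
    by (auto dest!: eventually_happens)
  have "D c \<in> COP"
  proof (rule copositive_by_peeling[where V = V])
    have "transpose (pencil_A A x) = pencil_A A x"
      using x by (simp add: feasible_set_def COP_def)
    then show "transpose (D c) = D c"
      using transpose_lincomb[of 1 "pencil_B A z" c "pencil_A A x"]
        transpose_pencil_B[of A z, OF symmetric] by (simp add: D_def)
    show "V \<subseteq> nonneg_orthant - {0}" using V(2) immobile_subset_nonneg[of A] by blast
    show "0 \<le> t \<bullet> (D c *v t)"
      if "t \<in> nonneg_orthant" "\<forall>v\<in>V. \<exists>k. 0 < v $ k \<and> t $ k = 0" for t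
      by (rule nonneg_form_if_nonneg_on_simplex[OF _ that]) (simp add: cK K_def)
  qed (rule cV)
  moreover obtain y where y: "D c = (z $ None + c) *\<^sub>R pencil_A A y"
    using pencil_B_plus_pencil_A[OF c] unfolding D_def by blast
  ultimately have scaled: "(z $ None + c) *\<^sub>R pencil_A A y \<in> COP" by simp
  have "y \<in> feasible_set A"
  proof -
    from convex_cone_scaleR[OF convex_cone_COP _ scaled, of "1 / (z $ None + c)"]
    show ?thesis using c by (simp add: feasible_set_def)
  qed
  then have "t \<bullet> (pencil_A A y *v t) = 0" using t by (simp add: immobile_set_def)
  then have "t \<bullet> (D c *v t) = 0"
    by (simp add: y flip: scaleR_matrix_vector_assoc)
  moreover have "t \<bullet> (pencil_A A x *v t) = 0" using t x by (simp add: immobile_set_def)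
  ultimately show ?thesis by (simp add: D)
qed

section \<open>Cones, subspaces and orthogonality\<close>

text \<open>If \<open>0\<close> were outside the relative interior, a supporting hyperplane at \<open>0\<close> would give a
  functional that is nonnegative on \<open>L\<close> and positive somewhere on it. If \<open>0\<close> is inside, each
  segment from \<open>y\<close> to \<open>0\<close> can be prolonged beyond \<open>0\<close> within \<open>L\<close>, which puts \<open>- y\<close>
  into the cone.\<close>

lemma subspace_if_no_proper_support:
  fixes L :: "'a::euclidean_space set"
  assumes L: "convex_cone L"
    and null: "\<And>z. \<forall>y\<in>L. 0 \<le> z \<bullet> y \<Longrightarrow> \<forall>y\<in>L. z \<bullet> y = 0"
  shows "subspace L"
proof -
  have convex: "convex L" using L by (simp add: convex_cone_def)
  have zero: "0 \<in> L" using L unfolding convex_cone_iff by blast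
  have "0 \<in> rel_interior L"
  proof (rule ccontr)
    assume "0 \<notin> rel_interior L"
    from supporting_hyperplane_rel_boundary[OF convex zero this]
    obtain z where nonneg: "\<And>y. y \<in> L \<Longrightarrow> z \<bullet> 0 \<le> z \<bullet> y"
      and pos: "\<And>y. y \<in> rel_interior L \<Longrightarrow> z \<bullet> 0 < z \<bullet> y"
      by metis
    have "\<forall>y\<in>L. 0 \<le> z \<bullet> y" using nonneg by simp
    then have vanishes: "\<forall>y\<in>L. z \<bullet> y = 0" by (rule null)
    obtain y where y: "y \<in> rel_interior L"
      using rel_interior_eq_empty[OF convex] zero by blast
    then have "y \<in> L" using rel_interior_subset by blast
    then show False using pos[OF y] vanishes by simp
  qed
  have neg: "- y \<in> L" if y: "y \<in> L" for y
  proof -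
    obtain e where e: "1 < e" "(1 - e) *\<^sub>R y + e *\<^sub>R 0 \<in> L"
      using convex_rel_interior_iff[OF convex] zero y \<open>0 \<in> rel_interior L\<close> by blast
    have "(1 / (e - 1)) *\<^sub>R ((1 - e) *\<^sub>R y) \<in> L"
      by (rule convex_cone_scaleR[OF L]) (use e in auto)
    moreover have "(1 / (e - 1)) * (1 - e) = - 1" using e(1) by (simp add: field_simps)
    ultimately show ?thesis by simp
  qed
  have "c *\<^sub>R y \<in> L" if "y \<in> L" for c y
  proof (cases "0 \<le> c")
    case True
    then show ?thesis using convex_cone_scaleR[OF L] that by blast
  next
    case False
    then show ?thesis using convex_cone_scaleR[OF L, of "- c" "- y"] neg[OF that] by simp
  qed
  then show ?thesis using zero convex_cone_add[OF L] by (simp add: subspace_def)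
qed

lemma in_subspace_if_orthogonal_complement_annihilates:
  fixes L :: "'a::euclidean_space set"
  assumes "subspace L" and "\<And>z. (\<And>y. y \<in> L \<Longrightarrow> z \<bullet> y = 0) \<Longrightarrow> z \<bullet> b = 0"
  shows "b \<in> L"
proof -
  have "b \<in> L\<^sup>\<bottom>\<^sup>\<bottom>"
    using assms(2) by (auto simp: orthogonal_comp_def orthogonal_def inner_commute)
  then show ?thesis using orthogonal_comp_self[OF assms(1)] by simp
qed

lemma gen_cone_superset: "B \<subseteq> gen_cone B"
  unfolding gen_cone_eq_convex_cone_hull by (rule hull_subset)

lemma orthogonal_gen_cone:
  assumes "\<And>b. b \<in> B \<Longrightarrow> z \<bullet> b = 0" "y \<in> gen_cone B"
  shows "z \<bullet> y = 0"
proof -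
  obtain F c where F: "F \<subseteq> B" and y: "y = (\<Sum>b\<in>F. c b *\<^sub>R b)"
    using assms(2) unfolding gen_cone_def by blast
  have "z \<bullet> y = (\<Sum>b\<in>F. c b * (z \<bullet> b))"
    unfolding y by (simp add: inner_sum_right)
  also have "\<dots> = 0"
    using F assms(1) by (intro sum.neutral) auto
  finally show ?thesis .
qed

text \<open>A point that carries positive weight in a convex combination of nonnegative vectors has its
  support inside that of the combination, since no cancellation is possible.\<close>

lemma convex_hull_support:
  fixes V :: "(real ^ 'p::finite) set"
  assumes V: "V \<subseteq> nonneg_orthant" and t: "t \<in> convex hull V"
  shows "\<exists>v\<in>V. \<forall>k. 0 < v $ k \<longrightarrow> 0 < t $ k"
proof -
  obtain F u where F: "finite F" "F \<subseteq> V" and u: "\<And>v. v \<in> F \<Longrightarrow> 0 \<le> u v" "sum u F = 1"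
    and t_eq: "(\<Sum>v\<in>F. u v *\<^sub>R v) = t"
    using t unfolding convex_hull_explicit by blast
  have "\<exists>v\<in>F. u v \<noteq> 0"
    using u(2) by (metis sum.neutral zero_neq_one)
  then obtain v where v: "v \<in> F" "0 < u v" using u(1) by force
  have "0 < t $ k" if "0 < v $ k" for k
  proof -
    have "0 < u v * v $ k" using v that by simp
    also have "\<dots> \<le> (\<Sum>w\<in>F. u w * w $ k)"
      using F V u(1) by (intro member_le_sum[OF v(1)]) (auto simp: nonneg_orthantD subset_iff)
    finally show ?thesis by (simp flip: t_eq)
  qed
  then show ?thesis using v F by blast
qed

lemma form_vanishes_on_convex_hull:
  fixes D :: "real ^ 'p::finite ^ 'p"
  assumes "\<And>v w. v \<in> V \<Longrightarrow> w \<in> V \<Longrightarrow> v \<bullet> (D *v w) = 0" and "t \<in> convex hull V"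
  shows "t \<bullet> (D *v t) = 0"
proof -
  obtain F u where F: "F \<subseteq> V" and t: "t = (\<Sum>v\<in>F. u v *\<^sub>R v)"
    using assms(2) unfolding convex_hull_explicit by blast
  have "D *v t = (\<Sum>v\<in>F. u v *\<^sub>R (D *v v))"
    unfolding t by (simp add: linear_sum[OF matrix_vector_mul_linear] matrix_vector_mult_scaleR)
  moreover have "v \<bullet> (D *v w) = 0" if "v \<in> F" "w \<in> F" for v w
    using assms(1) F that by blast
  ultimately show ?thesis
    by (simp add: t inner_sum_left inner_sum_right)
qed

text \<open>The converse of the preceding lemma: evaluate the form at the midpoint of \<open>v\<close> and \<open>w\<close>.\<close>

lemma form_vanishes_by_polarization:
  fixes D :: "real ^ 'p::finite ^ 'p"
  assumes sym: "transpose D = D"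
    and null: "\<And>t. t \<in> convex hull V \<Longrightarrow> t \<bullet> (D *v t) = 0" and v: "v \<in> V" "w \<in> V"
  shows "v \<bullet> (D *v w) = 0"
proof -
  have "(1/2) *\<^sub>R v + (1/2) *\<^sub>R w \<in> convex hull V"
    using v by (intro convexD[OF convex_convex_hull]) (auto intro: hull_inc)
  then have "((1/2) *\<^sub>R (v + w)) \<bullet> (D *v ((1/2) *\<^sub>R (v + w))) = 0"
    using null by (simp add: scaleR_add_right)
  then have "(v + 1 *\<^sub>R w) \<bullet> (D *v (v + 1 *\<^sub>R w)) = 0"
    by (simp add: matrix_vector_mult_scaleR)
  moreover have "v \<bullet> (D *v v) = 0" "w \<bullet> (D *v w) = 0"
    using null v by (auto intro: hull_inc)
  ultimately show ?thesis unfolding quadratic_form_add[OF sym] by simp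
qed

lemma ordered_pairs_cases:
  assumes "bij_betw num {1..k} I" "i \<in> I" "j \<in> I"
  shows "(i, j) \<in> ordered_pairs num k \<or> (j, i) \<in> ordered_pairs num k"
proof -
  obtain r q where "r \<in> {1..k}" "q \<in> {1..k}" "i = num r" "j = num q"
    using assms unfolding bij_betw_def by blast
  then show ?thesis unfolding ordered_pairs_def by (cases "r \<le> q") auto
qed

lemma ordered_pairs_subset:
  assumes "bij_betw num {1..k} I"
  shows "ordered_pairs num k \<subseteq> I \<times> I"
  using assms unfolding ordered_pairs_def bij_betw_def by force

theorem proposition5:
  fixes A :: "'n::finite option \<Rightarrow> real ^ 'p::finite ^ 'p"
    and J :: "'j set" and \<tau> :: "'j \<Rightarrow> real ^ 'p"
    and S :: "'s set" and Js :: "'s \<Rightarrow> 'j set" and num :: "'s \<Rightarrow> nat \<Rightarrow> 'j"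
    and V0 :: "('j \<times> 'j) set"
    and L :: "(real ^ 'n option) set"
  assumes p_gt_1: "CARD('p) > 1"
    and symmetric: "\<And>m. transpose (A m) = A m"
    and consistent: "feasible_set A \<noteq> {}"
    and finite_J: "finite J"
    and vertices: "bij_betw \<tau> J (immobile_vertices A)"
    and finite_S: "finite S"
    and Js_subset: "\<And>s. s \<in> S \<Longrightarrow> Js s \<subseteq> J"
    and decomposition: "immobile_set A = (\<Union>s\<in>S. convex hull (\<tau> ` Js s))"
    and supports: "\<And>s j. s \<in> S \<Longrightarrow> j \<in> Js s \<Longrightarrow>
                     (\<Union>i\<in>Js s. {k. \<tau> i $ k > 0}) \<subseteq> zero_rows A (\<tau> j)"
    and numbering: "\<And>s. s \<in> S \<Longrightarrow> bij_betw (num s) {1..card (Js s)} (Js s)"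
    and V0: "V0 = (\<Union>s\<in>S. ordered_pairs (num s) (card (Js s)))"
    and L: "L = gen_cone (vec_a A ` immobile_set A)"
  shows "(\<forall>j\<in>J. \<forall>k\<in>zero_rows A (\<tau> j). vec_b A k (\<tau> j) \<in> L) \<longleftrightarrow>
         (subspace L \<and>
          (\<forall>z. (\<forall>(i, j)\<in>V0. \<tau> i \<bullet> (pencil_B A z *v \<tau> j) = 0) \<longrightarrow>
               (\<forall>j\<in>J. \<forall>k\<in>zero_rows A (\<tau> j). axis k 1 \<bullet> (pencil_B A z *v \<tau> j) = 0)))"
proof -
  let ?V = "immobile_vertices A"
  have V: "?V = \<tau> ` J" using vertices by (simp add: bij_betw_def)
  have V_finite: "finite ?V" using finite_J V by simp
  have V_immobile: "?V \<subseteq> immobile_set A"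
    by (auto simp: immobile_vertices_def dest: extreme_point_of_convex_hull)
  have \<tau>_Js: "\<tau> ` Js s \<subseteq> ?V" if "s \<in> S" for s using Js_subset[OF that] V by blast
  have support: "\<exists>v\<in>?V. \<forall>k. 0 < v $ k \<longrightarrow> 0 < t $ k" if "t \<in> immobile_set A" for t
  proof (rule convex_hull_support)
    show "?V \<subseteq> nonneg_orthant" using V_immobile immobile_subset_nonneg[of A] by blast
    show "t \<in> convex hull ?V" using that \<tau>_Js hull_mono unfolding decomposition by blast
  qed
  have symB: "transpose (pencil_B A z) = pencil_B A z" for z
    by (rule transpose_pencil_B) (rule symmetric)
  have L_cone: "convex_cone L"
    unfolding L gen_cone_eq_convex_cone_hull by (rule convex_cone_convex_cone_hull)
  have perp_iff: "(\<forall>y\<in>L. z \<bullet> y = 0) \<longleftrightarrow> (\<forall>t\<in>immobile_set A. t \<bullet> (pencil_B A z *v t) = 0)" for z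
  proof
    assume "\<forall>y\<in>L. z \<bullet> y = 0"
    then show "\<forall>t\<in>immobile_set A. t \<bullet> (pencil_B A z *v t) = 0"
      using gen_cone_superset[of "vec_a A ` immobile_set A"] unfolding L inner_vec_a[symmetric]
      by blast
  next
    assume "\<forall>t\<in>immobile_set A. t \<bullet> (pencil_B A z *v t) = 0"
    then have "z \<bullet> b = 0" if "b \<in> vec_a A ` immobile_set A" for b
      using that by (auto simp: inner_vec_a)
    then show "\<forall>y\<in>L. z \<bullet> y = 0"
      unfolding L using orthogonal_gen_cone by blast
  qed
  \<comment> \<open>Both sides say that the form of \<open>B(z)\<close> vanishes on every piece of the immobile set.\<close>
  have V0_iff: "(\<forall>(i, j)\<in>V0. \<tau> i \<bullet> (pencil_B A z *v \<tau> j) = 0) \<longleftrightarrow> (\<forall>y\<in>L. z \<bullet> y = 0)"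
    (is "?pairs \<longleftrightarrow> _") for z
  proof -
    have "\<tau> i \<bullet> (pencil_B A z *v \<tau> j) = 0"
      if ?pairs and "s \<in> S" "i \<in> Js s" "j \<in> Js s" for s i j
    proof -
      have "(i, j) \<in> V0 \<or> (j, i) \<in> V0"
        using ordered_pairs_cases[OF numbering that(3,4)] that(2) unfolding V0 by blast
      then show ?thesis
        using that(1) form_symmetric[OF symB, of "\<tau> i" z "\<tau> j"] by force
    qed
    then have "\<forall>t\<in>immobile_set A. t \<bullet> (pencil_B A z *v t) = 0" if ?pairs
      using that form_vanishes_on_convex_hull[of "\<tau> ` Js _" "pencil_B A z"]
      unfolding decomposition by blast
    moreover have ?pairs if null: "\<forall>t\<in>immobile_set A. t \<bullet> (pencil_B A z *v t) = 0"
    proof clarify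
      fix i j assume "(i, j) \<in> V0"
      then obtain s where s: "s \<in> S" "i \<in> Js s" "j \<in> Js s"
        using ordered_pairs_subset[OF numbering] unfolding V0 by blast
      show "\<tau> i \<bullet> (pencil_B A z *v \<tau> j) = 0"
        by (rule form_vanishes_by_polarization[OF symB, of "\<tau> ` Js s"])
          (use s null decomposition in auto)
    qed
    ultimately show ?thesis unfolding perp_iff by blast
  qed
  show ?thesis
  proof (intro iffI conjI allI impI ballI)
    assume I: "\<forall>j\<in>J. \<forall>k\<in>zero_rows A (\<tau> j). vec_b A k (\<tau> j) \<in> L"
    show "subspace L"
    proof (rule subspace_if_no_proper_support[OF L_cone])
      fix z assume nonneg: "\<forall>y\<in>L. 0 \<le> z \<bullet> y"
      have "0 \<le> axis k 1 \<bullet> (pencil_B A z *v v)" if "v \<in> ?V" "k \<in> zero_rows A v" for v k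
        using I that nonneg unfolding V inner_vec_b[symmetric] by auto
      then have "\<forall>t\<in>immobile_set A. t \<bullet> (pencil_B A z *v t) = 0"
        using immobile_form_vanishes[OF symmetric consistent V_finite V_immobile support] by blast
      then show "\<forall>y\<in>L. z \<bullet> y = 0" using perp_iff by blast
    qed
  next
    fix z j k
    assume "\<forall>j\<in>J. \<forall>k\<in>zero_rows A (\<tau> j). vec_b A k (\<tau> j) \<in> L"
      and "\<forall>(i, j)\<in>V0. \<tau> i \<bullet> (pencil_B A z *v \<tau> j) = 0" "j \<in> J" "k \<in> zero_rows A (\<tau> j)"
    then show "axis k 1 \<bullet> (pencil_B A z *v \<tau> j) = 0"
      unfolding V0_iff inner_vec_b[symmetric] by blast
  next
    fix j k
    assume AB: "subspace L \<and>
          (\<forall>z. (\<forall>(i, j)\<in>V0. \<tau> i \<bullet> (pencil_B A z *v \<tau> j) = 0) \<longrightarrow>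
               (\<forall>j\<in>J. \<forall>k\<in>zero_rows A (\<tau> j). axis k 1 \<bullet> (pencil_B A z *v \<tau> j) = 0))"
      and jk: "j \<in> J" "k \<in> zero_rows A (\<tau> j)"
    show "vec_b A k (\<tau> j) \<in> L"
    proof (rule in_subspace_if_orthogonal_complement_annihilates)
      show "subspace L" using AB by blast
      show "z \<bullet> vec_b A k (\<tau> j) = 0" if "\<And>y. y \<in> L \<Longrightarrow> z \<bullet> y = 0" for z
        using AB jk that unfolding V0_iff inner_vec_b by blast
    qed
  qed
qed

end
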